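(* Let $\Gamma$ be a countable graph. Then (i) there exists an idempotent endomorphism $f$ of the countable universal graph $R$ such that $\operatorname{im} f\cong\Gamma$ if and only if $\Gamma$ is algebraically closed; (ii) if $\Gamma$ is algebraically closed, there are $2^{\aleph_0}$ idempotent endomorphisms $f$ of $R$ such that $\operatorname{im} f\cong\Gamma$.
   Context: A graph is a pair $(V,E)$ with $E$ an irreflexive symmetric binary relation on $V$. A graph is algebraically closed if for every finite set $A$ of vertices there is a vertex adjacent to every vertex of $A$. The countable universal graph $R$ is the Fraïssé limit of the finite graphs (the unique countable existentially closed graph). For an endomorphism $f$ of $R=(V,E)$, $\operatorname{im} f$ is the graph $(Vf,Ef)$. *)

theory Defs
  imports "HOL-Library.FuncSet" "HOL-Library.Countable_Set" "HOL-Library.Equipollence"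
begin

type_synonym 'a graph = "'a set \<times> ('a \<times> 'a) set"

abbreviation verts :: "'a graph \<Rightarrow> 'a set" where "verts \<equiv> fst"
abbreviation edges :: "'a graph \<Rightarrow> ('a \<times> 'a) set" where "edges \<equiv> snd"

definition is_graph :: "'a graph \<Rightarrow> bool" where
  "is_graph G \<longleftrightarrow> edges G \<subseteq> verts G \<times> verts G \<and> irrefl (edges G) \<and> sym (edges G)"

definition countable_graph :: "'a graph \<Rightarrow> bool" where
  "countable_graph G \<longleftrightarrow> is_graph G \<and> countable (verts G)"

definition finite_graph :: "'a graph \<Rightarrow> bool" where
  "finite_graph G \<longleftrightarrow> is_graph G \<and> finite (verts G)"

definition algebraically_closed :: "'a graph \<Rightarrow> bool" where
  "algebraically_closed G \<longleftrightarrow>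
     (\<forall>A. finite A \<and> A \<subseteq> verts G \<longrightarrow> (\<exists>v\<in>verts G. \<forall>a\<in>A. (v, a) \<in> edges G))"

definition induced_subgraph :: "'a graph \<Rightarrow> 'a set \<Rightarrow> 'a graph" where
  "induced_subgraph G A = (A, edges G \<inter> A \<times> A)"

definition graph_iso :: "('a \<Rightarrow> 'b) \<Rightarrow> 'a graph \<Rightarrow> 'b graph \<Rightarrow> bool" where
  "graph_iso h G H \<longleftrightarrow> bij_betw h (verts G) (verts H) \<and>
     (\<forall>x\<in>verts G. \<forall>y\<in>verts G. (x, y) \<in> edges G \<longleftrightarrow> (h x, h y) \<in> edges H)"

definition isomorphic :: "'a graph \<Rightarrow> 'b graph \<Rightarrow> bool"  (infix "\<cong>\<^sub>g" 50) where
  "G \<cong>\<^sub>g H \<longleftrightarrow> (\<exists>h. graph_iso h G H)"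

text \<open>The age of a graph is the class of finite graphs isomorphic to one of its induced
  subgraphs. Every finite graph is isomorphic to one whose vertices are natural numbers, so
  such graphs represent all members of this class.\<close>

definition age :: "'a graph \<Rightarrow> nat graph set" where
  "age G = {F. finite_graph F \<and> (\<exists>A\<subseteq>verts G. F \<cong>\<^sub>g induced_subgraph G A)}"

definition homogeneous :: "'a graph \<Rightarrow> bool" where
  "homogeneous G \<longleftrightarrow>
     (\<forall>A B h. A \<subseteq> verts G \<and> finite A \<and> B \<subseteq> verts G \<and>
        graph_iso h (induced_subgraph G A) (induced_subgraph G B) \<longrightarrow>
        (\<exists>g. graph_iso g G G \<and> (\<forall>x\<in>A. g x = h x)))"

text \<open>The Fraisse limit of a class of finite graphs is the countable homogeneous graph,
  unique up to isomorphism, having that class as its age.\<close>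

definition fraisse_limit :: "nat graph set \<Rightarrow> 'a graph \<Rightarrow> bool" where
  "fraisse_limit K G \<longleftrightarrow> countable_graph G \<and> homogeneous G \<and> age G = K"

definition countable_universal_graph :: "'a graph \<Rightarrow> bool" where
  "countable_universal_graph G \<longleftrightarrow> fraisse_limit {F. finite_graph F} G"

text \<open>Endomorphisms are extensional functions, undefined outside the vertex set, so that
  each endomorphism is represented, and hence counted, exactly once.\<close>

definition endomorphisms :: "'a graph \<Rightarrow> ('a \<Rightarrow> 'a) set" where
  "endomorphisms G =
     {f \<in> verts G \<rightarrow>\<^sub>E verts G. \<forall>(x, y)\<in>edges G. (f x, f y) \<in> edges G}"

definition idempotent_endomorphisms :: "'a graph \<Rightarrow> ('a \<Rightarrow> 'a) set" where
  "idempotent_endomorphisms G = {f \<in> endomorphisms G. compose (verts G) f f = f}"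

definition image_graph :: "('a \<Rightarrow> 'a) \<Rightarrow> 'a graph \<Rightarrow> 'a graph" where
  "image_graph f G = (f ` verts G, map_prod f f ` edges G)"

end

theory Submission
  imports Defs
begin

text \<open>
  An idempotent endomorphism of \<open>R\<close> with image \<open>\<Gamma>\<close> is the same as a pair of homomorphisms
  \<open>\<phi> : R \<rightarrow> \<Gamma>\<close> and \<open>e : \<Gamma> \<rightarrow> R\<close> with \<open>\<phi> \<circ> e = id\<close>. Such a pair is built as the union of finite
  partial homomorphisms \<open>R \<rightarrow> \<Gamma>\<close>: algebraic closure of \<open>\<Gamma>\<close> allows any further vertex of \<open>R\<close>
  to be added to the domain, and the extension property of \<open>R\<close> provides a new preimage of a
  given \<open>\<gamma>\<close> that is adjacent to every earlier vertex whose value is adjacent to \<open>\<gamma>\<close>.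

  For the cardinality, replace every vertex of \<open>\<Gamma>\<close> by two nonadjacent twins. The resulting graph
  is again algebraically closed, hence a retract of \<open>R\<close>, and selecting one twin of each vertex of
  the infinite graph \<open>\<Gamma>\<close> yields a continuum of sections of one homomorphism \<open>R \<rightarrow> \<Gamma>\<close>.
\<close>

section \<open>Homomorphisms, the extension property and twins\<close>

definition graph_hom :: "('a \<Rightarrow> 'b) \<Rightarrow> 'a graph \<Rightarrow> 'b graph \<Rightarrow> bool" where
  "graph_hom f G H \<longleftrightarrow> f ` verts G \<subseteq> verts H \<and> (\<forall>(x, y)\<in>edges G. (f x, f y) \<in> edges H)"

definition extension_property :: "'a graph \<Rightarrow> bool" where
  "extension_property G \<longleftrightarrow>
     (\<forall>A U. finite A \<and> A \<subseteq> verts G \<and> U \<subseteq> A \<longrightarrow>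
       (\<exists>z\<in>verts G - A. \<forall>a\<in>A. (z, a) \<in> edges G \<longleftrightarrow> a \<in> U))"

text \<open>The lexicographic product of \<open>G\<close> with the edgeless graph on two
  vertices.\<close>

definition twin_graph :: "'a graph \<Rightarrow> ('a \<times> bool) graph" where
  "twin_graph G = (verts G \<times> UNIV, {(p, q). (fst p, fst q) \<in> edges G})"

lemma is_graph_edgeD:
  assumes "is_graph G" "(x, y) \<in> edges G"
  shows "x \<in> verts G" "y \<in> verts G" "x \<noteq> y" "(y, x) \<in> edges G"
  using assms by (auto simp: is_graph_def irrefl_def sym_def)

text \<open>The age contains the graph induced on \<open>A\<close> together with one new vertex
  joined exactly to \<open>U\<close>. Homogeneity carries a copy of it inside \<open>R\<close> back
  onto \<open>A\<close>, and the new vertex becomes the witness.\<close>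

lemma universal_extension_property:
  assumes "countable_universal_graph R"
  shows "extension_property R"
  unfolding extension_property_def
proof (intro allI impI, elim conjE)
  fix A U assume A: "finite A" "A \<subseteq> verts R" and U: "U \<subseteq> A"
  have R: "is_graph R" "homogeneous R" "age R = {F. finite_graph F}"
    using assms by (auto simp: countable_universal_graph_def fraisse_limit_def countable_graph_def)
  obtain k where k: "bij_betw k A {0..<card A}"
    using ex_bij_betw_finite_nat[OF A(1)] by blast
  define n where "n = card A"
  have kn: "k a < n" if "a \<in> A" for a
    using bij_betwE[OF k] that by (auto simp: n_def)
  have kinj: "k a = k b \<longleftrightarrow> a = b" if "a \<in> A" "b \<in> A" for a b
    using k that by (auto simp: bij_betw_def inj_on_def)
  \<comment> \<open>The numbers below \<open>n\<close> carry a copy of the graph induced on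
    \<open>A\<close>; \<open>n\<close> itself is the new vertex.\<close>
  define F where "F = ({..n}, {(k a, k b) |a b. a \<in> A \<and> b \<in> A \<and> (a, b) \<in> edges R}
      \<union> {(n, k a) |a. a \<in> U} \<union> {(k a, n) |a. a \<in> U})"
  have F_old: "(k a, k b) \<in> edges F \<longleftrightarrow> (a, b) \<in> edges R" if "a \<in> A" "b \<in> A" for a b
    using that kn[OF that(1)] kn[OF that(2)] by (auto simp: F_def kinj)
  have F_new: "(n, k a) \<in> edges F \<longleftrightarrow> a \<in> U" if "a \<in> A" for a
  proof -
    have "a = b" if "b \<in> U" "k a = k b" for b
      using that \<open>a \<in> A\<close> U kinj by blast
    then show ?thesis
      using that kn by (force simp: F_def)
  qed
  have "is_graph F"
    unfolding is_graph_def
  proof (intro conjI)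
    show "edges F \<subseteq> verts F \<times> verts F"
      using kn U by (auto simp: F_def intro: less_imp_le)
    show "irrefl (edges F)"
      using kn U kinj is_graph_edgeD(3)[OF R(1)] by (fastforce simp: F_def irrefl_def)
    show "sym (edges F)"
      using is_graph_edgeD(4)[OF R(1)] unfolding F_def sym_def snd_conv by blast
  qed
  then have "F \<in> age R"
    by (simp add: R(3) finite_graph_def F_def)
  then obtain B h where B: "B \<subseteq> verts R" and h: "graph_iso h F (induced_subgraph R B)"
    by (auto simp: age_def isomorphic_def)
  have hinj: "inj_on h {..n}" and hB: "\<And>i. i \<le> n \<Longrightarrow> h i \<in> B"
    and hE: "\<And>i j. i \<le> n \<Longrightarrow> j \<le> n \<Longrightarrow> (h i, h j) \<in> edges R \<longleftrightarrow> (i, j) \<in> edges F"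
    using h by (auto simp: graph_iso_def induced_subgraph_def F_def bij_betw_def)
  have "graph_iso (h \<circ> k) (induced_subgraph R A) (induced_subgraph R ((h \<circ> k) ` A))"
  proof -
    have "inj_on (h \<circ> k) A"
      using kn kinj by (intro inj_onI) (auto simp: inj_on_eq_iff[OF hinj] less_imp_le)
    moreover have "(h (k a), h (k b)) \<in> edges R \<longleftrightarrow> (a, b) \<in> edges R" if "a \<in> A" "b \<in> A" for a b
      using that kn by (simp add: hE F_old less_imp_le)
    ultimately show ?thesis
      by (auto simp: graph_iso_def induced_subgraph_def bij_betw_def)
  qed
  moreover have "(h \<circ> k) ` A \<subseteq> verts R"
    using kn hB B by (auto dest!: less_imp_le)
  ultimately obtain g where g: "graph_iso g R R" and gh: "\<forall>x\<in>A. g x = h (k x)"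
    using R(2) A unfolding homogeneous_def by (metis comp_apply)
  \<comment> \<open>The automorphism \<open>g\<close> sends \<open>A\<close> onto its copy inside
    \<open>B\<close>, so the witness is the preimage under \<open>g\<close> of the new vertex
    \<open>h n\<close>.\<close>
  have "h n \<in> g ` verts R"
    using g hB[of n] B by (auto simp: graph_iso_def bij_betw_def)
  then obtain z where z: "z \<in> verts R" "g z = h n"
    by auto
  have "z \<notin> A"
  proof
    assume "z \<in> A"
    then have "h (k z) = h n" using gh z by simp
    then show False
      using kn[OF \<open>z \<in> A\<close>] inj_onD[OF hinj] by fastforce
  qed
  moreover have "(z, a) \<in> edges R \<longleftrightarrow> a \<in> U" if "a \<in> A" for a
  proof -
    have "(z, a) \<in> edges R \<longleftrightarrow> (g z, g a) \<in> edges R"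
      using g z that A by (auto simp: graph_iso_def)
    also have "\<dots> \<longleftrightarrow> (h n, h (k a)) \<in> edges R"
      using z gh that by simp
    also have "\<dots> \<longleftrightarrow> a \<in> U"
      using that kn by (simp add: hE F_new less_imp_le)
    finally show ?thesis .
  qed
  ultimately show "\<exists>z\<in>verts R - A. \<forall>a\<in>A. (z, a) \<in> edges R \<longleftrightarrow> a \<in> U"
    using z by blast
qed

section \<open>Preservation of algebraic closure\<close>

lemma extension_property_imp_algebraically_closed:
  "extension_property G \<Longrightarrow> algebraically_closed G"
  unfolding extension_property_def algebraically_closed_def by (metis DiffD1 order_refl)

lemma algebraically_closed_isomorphic:
  assumes "algebraically_closed G" "G \<cong>\<^sub>g H"
  shows "algebraically_closed H"
  unfolding algebraically_closed_def
proof (intro allI impI, elim conjE)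
  fix A assume A: "finite A" "A \<subseteq> verts H"
  obtain h where h: "graph_iso h G H"
    using assms by (auto simp: isomorphic_def)
  then have "A \<subseteq> h ` verts G"
    using A by (auto simp: graph_iso_def bij_betw_def)
  then obtain B where B: "B \<subseteq> verts G" "finite B" "A = h ` B"
    using A(1) finite_subset_image by metis
  then obtain v where "v \<in> verts G" "\<forall>b\<in>B. (v, b) \<in> edges G"
    using assms(1) by (auto simp: algebraically_closed_def)
  then show "\<exists>v\<in>verts H. \<forall>a\<in>A. (v, a) \<in> edges H"
    using h B by (intro bexI[of _ "h v"]) (auto simp: graph_iso_def bij_betw_def subset_iff)
qed

text \<open>Idempotence makes every vertex of the image a fixed point, so \<open>f\<close> maps a
  common neighbour of \<open>A\<close> in \<open>G\<close> to a common neighbour of \<open>A\<close>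
  in the image.\<close>

lemma algebraically_closed_image_graph:
  assumes "algebraically_closed G" "f \<in> idempotent_endomorphisms G"
  shows "algebraically_closed (image_graph f G)"
  unfolding algebraically_closed_def
proof (intro allI impI, elim conjE)
  fix A assume A: "finite A" "A \<subseteq> verts (image_graph f G)"
  have f: "f ` verts G \<subseteq> verts G" "\<And>x. x \<in> verts G \<Longrightarrow> f (f x) = f x"
    using assms(2) by (auto simp: idempotent_endomorphisms_def endomorphisms_def compose_def
        fun_eq_iff PiE_iff split: if_splits)
  have A': "A \<subseteq> verts G" "\<And>a. a \<in> A \<Longrightarrow> f a = a"
    using A(2) f by (auto simp: image_graph_def)
  then obtain v where v: "v \<in> verts G" "\<forall>a\<in>A. (v, a) \<in> edges G"
    using assms(1) A(1) by (auto simp: algebraically_closed_def)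
  have "(f v, a) \<in> map_prod f f ` edges G" if "a \<in> A" for a
    using v A' that by (intro image_eqI[of _ _ "(v, a)"]) auto
  then show "\<exists>v\<in>verts (image_graph f G). \<forall>a\<in>A. (v, a) \<in> edges (image_graph f G)"
    using v by (auto simp: image_graph_def)
qed

text \<open>A common neighbour of all vertices would be adjacent to itself.\<close>

lemma algebraically_closed_infinite:
  assumes "is_graph G" "algebraically_closed G"
  shows "infinite (verts G)"
proof
  assume "finite (verts G)"
  then obtain v where "v \<in> verts G" "\<forall>a\<in>verts G. (v, a) \<in> edges G"
    using assms(2) unfolding algebraically_closed_def by blast
  then show False
    using is_graph_edgeD(3)[OF assms(1)] by blast
qed

lemma twin_graph_countable:
  assumes "countable_graph G"
  shows "countable_graph (twin_graph G)"
  using assms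
  by (auto simp: countable_graph_def is_graph_def twin_graph_def irrefl_def sym_def)

lemma twin_graph_algebraically_closed:
  assumes "algebraically_closed G"
  shows "algebraically_closed (twin_graph G)"
  unfolding algebraically_closed_def
proof (intro allI impI, elim conjE)
  fix A assume A: "finite A" "A \<subseteq> verts (twin_graph G)"
  then have "finite (fst ` A)" "fst ` A \<subseteq> verts G"
    by (auto simp: twin_graph_def)
  then obtain v where "v \<in> verts G" "\<forall>a\<in>fst ` A. (v, a) \<in> edges G"
    using assms by (auto simp: algebraically_closed_def)
  then show "\<exists>v\<in>verts (twin_graph G). \<forall>a\<in>A. (v, a) \<in> edges (twin_graph G)"
    by (intro bexI[of _ "(v, True)"]) (auto simp: twin_graph_def)
qed

section \<open>Finite partial homomorphisms\<close>

text \<open>Encoded as a relation, so that extension is inclusion and the limit of a chain is its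
  union.\<close>

definition partial_hom :: "'a graph \<Rightarrow> 'b graph \<Rightarrow> ('a \<times> 'b) set \<Rightarrow> bool" where
  "partial_hom G H P \<longleftrightarrow> P \<subseteq> verts G \<times> verts H \<and> single_valued P \<and>
     (\<forall>(x, a)\<in>P. \<forall>(y, b)\<in>P. (x, y) \<in> edges G \<longrightarrow> (a, b) \<in> edges H)"

text \<open>Only edges leaving \<open>v\<close> need checking: symmetry settles those entering
  \<open>v\<close>, and irreflexivity excludes a loop.\<close>

lemma partial_hom_insert:
  assumes "is_graph G" "is_graph H" "partial_hom G H P"
    and "v \<in> verts G" "c \<in> verts H" "v \<notin> Domain P"
    and "\<And>x a. (x, a) \<in> P \<Longrightarrow> (v, x) \<in> edges G \<Longrightarrow> (c, a) \<in> edges H"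
  shows "partial_hom G H (insert (v, c) P)"
proof -
  have P: "P \<subseteq> verts G \<times> verts H" "single_valued P"
      "\<And>x y a b. (x, a) \<in> P \<Longrightarrow> (y, b) \<in> P \<Longrightarrow> (x, y) \<in> edges G \<Longrightarrow> (a, b) \<in> edges H"
    using assms(3) by (auto simp: partial_hom_def)
  have "(a, b) \<in> edges H"
    if "(x, a) \<in> insert (v, c) P" "(y, b) \<in> insert (v, c) P" "(x, y) \<in> edges G" for x y a b
    using that P(3)[of x a y b] assms(7)[of x a] assms(7)[of y b]
      is_graph_edgeD(3,4)[OF assms(1) that(3)] is_graph_edgeD(4)[OF assms(2)] by auto
  moreover have "single_valued (insert (v, c) P)"
    using P(2) assms(6) by (auto simp: single_valued_def)
  ultimately show ?thesis
    using P(1) assms(4,5) unfolding partial_hom_def by fast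
qed

text \<open>A common neighbour of the whole finite range is a safe value for \<open>v\<close>,
  whichever edges \<open>v\<close> has.\<close>

lemma partial_hom_extend_domain:
  assumes "is_graph G" "is_graph H" "algebraically_closed H"
    and "partial_hom G H P" "finite P" "v \<in> verts G"
  obtains Q where "partial_hom G H Q" "finite Q" "P \<subseteq> Q" "v \<in> Domain Q"
proof (cases "v \<in> Domain P")
  case True
  then show ?thesis using that assms by blast
next
  case False
  have "finite (Range P)" "Range P \<subseteq> verts H"
    using assms by (auto simp: partial_hom_def finite_Range)
  then obtain c where c: "c \<in> verts H" "\<forall>a\<in>Range P. (c, a) \<in> edges H"
    using assms(3) by (auto simp: algebraically_closed_def)
  have "partial_hom G H (insert (v, c) P)"
    using assms c False by (intro partial_hom_insert) auto
  then show ?thesis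
    using that assms(5) by blast
qed

text \<open>The new \<open>v\<close> is joined to exactly those vertices of the domain whose value
  is adjacent to \<open>c\<close>. One direction keeps the extension a homomorphism; the other,
  recorded in the conclusion, later makes the section \<open>e\<close> preserve edges.\<close>

lemma partial_hom_extend_range:
  assumes "is_graph G" "is_graph H" "extension_property G"
    and "partial_hom G H P" "finite P" "c \<in> verts H"
  obtains v where "partial_hom G H (insert (v, c) P)"
    "\<And>x a. (x, a) \<in> P \<Longrightarrow> (c, a) \<in> edges H \<Longrightarrow> (v, x) \<in> edges G"
proof -
  define U where "U = {x. \<exists>a. (x, a) \<in> P \<and> (c, a) \<in> edges H}"
  have "finite (Domain P)" "Domain P \<subseteq> verts G" "U \<subseteq> Domain P"
    using assms by (auto simp: partial_hom_def finite_Domain U_def)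
  then obtain v where v: "v \<in> verts G - Domain P"
      "\<forall>x\<in>Domain P. (v, x) \<in> edges G \<longleftrightarrow> x \<in> U"
    using assms(3) unfolding extension_property_def by meson
  have "(c, a) \<in> edges H" if xa: "(x, a) \<in> P" "(v, x) \<in> edges G" for x a
  proof -
    obtain b where "(x, b) \<in> P" "(c, b) \<in> edges H"
      using v(2) xa unfolding U_def by blast
    then show ?thesis
      using assms(4) xa by (auto simp: partial_hom_def single_valued_def)
  qed
  then have "partial_hom G H (insert (v, c) P)"
    using assms v by (intro partial_hom_insert) auto
  then show ?thesis
    using that v by (auto simp: U_def)
qed

section \<open>Retractions onto algebraically closed graphs\<close>

lemma retraction_exists:
  fixes R :: "'a graph" and \<Gamma> :: "'b graph"
  assumes R: "countable_graph R" "extension_property R"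
    and G: "countable_graph \<Gamma>" "algebraically_closed \<Gamma>"
  obtains \<phi> e where "graph_hom \<phi> R \<Gamma>" "graph_hom e \<Gamma> R" "\<And>c. c \<in> verts \<Gamma> \<Longrightarrow> \<phi> (e c) = c"
proof -
  have gr: "is_graph R" "is_graph \<Gamma>" and cnt: "countable (verts R)" "countable (verts \<Gamma>)"
    using assms by (auto simp: countable_graph_def)
  \<comment> \<open>Nonemptiness ensures that the enumerations by \<open>from_nat_into\<close> stay
    inside the vertex sets.\<close>
  have ne: "verts R \<noteq> {}" "verts \<Gamma> \<noteq> {}"
    using R(2)[unfolded extension_property_def, rule_format, of "{}" "{}"]
      G(2)[unfolded algebraically_closed_def, rule_format, of "{}"] by auto
  define r where "r = from_nat_into (verts R)"
  define g where "g = from_nat_into (verts \<Gamma>)"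
  have r: "r n \<in> verts R" and g: "g n \<in> verts \<Gamma>" for n
    using ne by (auto simp: r_def g_def from_nat_into)
  \<comment> \<open>Stage \<open>n\<close> adds a preimage \<open>v\<close> of \<open>g n\<close>
    and puts \<open>r n\<close> into the domain. Adjacency of \<open>v\<close> is demanded towards
    the pairs of the earlier \<open>P\<close> only.\<close>
  define step where "step n P Q \<longleftrightarrow> P \<subseteq> Q \<and> r n \<in> Domain Q \<and>
      (\<exists>v. (v, g n) \<in> Q \<and> (\<forall>x a. (x, a) \<in> P \<longrightarrow> (g n, a) \<in> edges \<Gamma> \<longrightarrow> (v, x) \<in> edges R))"
    for n and P Q :: "('a \<times> 'b) set"
  have "\<exists>P. \<forall>n. (partial_hom R \<Gamma> (P n) \<and> finite (P n)) \<and> step n (P n) (P (Suc n))"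
  proof (rule dependent_nat_choice, goal_cases)
    case 1
    then show ?case by (intro exI[of _ "{}"]) (auto simp: partial_hom_def)
  next
    case (2 P n)
    then obtain v where v: "partial_hom R \<Gamma> (insert (v, g n) P)"
      "\<And>x a. (x, a) \<in> P \<Longrightarrow> (g n, a) \<in> edges \<Gamma> \<Longrightarrow> (v, x) \<in> edges R"
      using partial_hom_extend_range[OF gr R(2) _ _ g] by metis
    obtain Q where "partial_hom R \<Gamma> Q" "finite Q" "insert (v, g n) P \<subseteq> Q" "r n \<in> Domain Q"
      using partial_hom_extend_domain[OF gr G(2) v(1) _ r] 2 by blast
    then show ?case
      using v(2) unfolding step_def by blast
  qed
  then obtain P where P: "\<And>n. partial_hom R \<Gamma> (P n)" "\<And>n. step n (P n) (P (Suc n))"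
    by blast
  have "\<forall>n. \<exists>v. (v, g n) \<in> P (Suc n) \<and>
      (\<forall>x a. (x, a) \<in> P n \<longrightarrow> (g n, a) \<in> edges \<Gamma> \<longrightarrow> (v, x) \<in> edges R)"
    using P(2) unfolding step_def by blast
  from choice[OF this] obtain v where v: "\<And>n. (v n, g n) \<in> P (Suc n)"
    "\<And>n x a. (x, a) \<in> P n \<Longrightarrow> (g n, a) \<in> edges \<Gamma> \<Longrightarrow> (v n, x) \<in> edges R"
    by blast
  have mono: "P m \<subseteq> P n" if "m \<le> n" for m n
  proof (rule lift_Suc_mono_le[OF _ that])
    show "P i \<subseteq> P (Suc i)" for i
      using P(2)[of i] unfolding step_def by blast
  qed
  define T where "T = (\<Union>n. P n)"
  have T: "partial_hom R \<Gamma> T"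
  proof -
    \<comment> \<open>The stages form a chain, so each condition on two pairs of \<open>T\<close>
      can be checked at one stage.\<close>
    have common: "\<exists>n. p \<in> P n \<and> q \<in> P n" if "p \<in> T" "q \<in> T" for p q
      using that mono unfolding T_def by (metis UN_iff in_mono nat_le_linear)
    have "single_valued T"
    proof (rule single_valuedI)
      fix x a b assume "(x, a) \<in> T" "(x, b) \<in> T"
      then obtain n where "(x, a) \<in> P n" "(x, b) \<in> P n"
        using common by blast
      then show "a = b"
        using P(1)[of n] unfolding partial_hom_def single_valued_def by blast
    qed
    moreover have "(a, b) \<in> edges \<Gamma>" if "(x, a) \<in> T" "(y, b) \<in> T" "(x, y) \<in> edges R" for x y a b
      using common[OF that(1,2)] P(1) that(3) unfolding partial_hom_def by fast
    moreover have "T \<subseteq> verts R \<times> verts \<Gamma>"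
      using P(1) by (force simp: T_def partial_hom_def)
    ultimately show ?thesis
      by (auto simp: partial_hom_def)
  qed
  have total: "\<exists>a. (x, a) \<in> T" if "x \<in> verts R" for x
  proof -
    obtain n where "r n = x"
      using from_nat_into_surj[OF cnt(1) \<open>x \<in> verts R\<close>] by (auto simp: r_def)
    then show ?thesis
      using P(2)[of n] by (auto simp: step_def T_def)
  qed
  define \<phi> where "\<phi> x = (SOME a. (x, a) \<in> T)" for x
  have phi: "(x, \<phi> x) \<in> T" if "x \<in> verts R" for x
    using someI_ex[OF total[OF that]] by (simp add: \<phi>_def)
  have phi_eq: "\<phi> x = a" if "(x, a) \<in> T" for x a
    using T phi[of x] that unfolding partial_hom_def single_valued_def by blast
  \<comment> \<open>The section picks the preimage added at the stage whose number is the index of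
    \<open>c\<close>.\<close>
  define e where "e c = v (to_nat_on (verts \<Gamma>) c)" for c
  have vT: "(v n, g n) \<in> T" for n
    using v(1) by (auto simp: T_def)
  have ge: "g (to_nat_on (verts \<Gamma>) c) = c" if "c \<in> verts \<Gamma>" for c
    using that cnt by (simp add: g_def)
  \<comment> \<open>The pair \<open>(v m, g m)\<close> enters at stage \<open>Suc m\<close>, hence
    is already in \<open>P n\<close> when \<open>v n\<close> is chosen. Symmetry then gives the case
    \<open>n < m\<close>, and irreflexivity rules out \<open>m = n\<close>.\<close>
  have less: "(v n, v m) \<in> edges R" if "m < n" "(g n, g m) \<in> edges \<Gamma>" for m n
    using v(1)[of m] v(2)[of "v m" "g m" n] mono[of "Suc m" n] that by (auto simp: Suc_le_eq)
  have vE: "(v n, v m) \<in> edges R" if "(g n, g m) \<in> edges \<Gamma>" for m n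
    using less[of m n] less[of n m] that is_graph_edgeD(3,4)[OF gr(2) that]
      is_graph_edgeD(4)[OF gr(1)] by (metis linorder_neqE_nat)
  show ?thesis
  proof
    have "(\<phi> x, \<phi> y) \<in> edges \<Gamma>" if "(x, y) \<in> edges R" for x y
      using T that phi[OF is_graph_edgeD(1)[OF gr(1) that]] phi[OF is_graph_edgeD(2)[OF gr(1) that]]
      unfolding partial_hom_def by fast
    moreover have "\<phi> x \<in> verts \<Gamma>" if "x \<in> verts R" for x
      using T phi[OF that] by (auto simp: partial_hom_def)
    ultimately show "graph_hom \<phi> R \<Gamma>"
      by (auto simp: graph_hom_def)
    have "e c \<in> verts R" if "c \<in> verts \<Gamma>" for c
      using vT T by (auto simp: e_def partial_hom_def)
    moreover have "(e c, e d) \<in> edges R" if "(c, d) \<in> edges \<Gamma>" for c d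
      using vE that ge is_graph_edgeD(1,2)[OF gr(2) that] by (simp add: e_def)
    ultimately show "graph_hom e \<Gamma> R"
      by (auto simp: graph_hom_def)
    show "\<phi> (e c) = c" if "c \<in> verts \<Gamma>" for c
      using phi_eq[OF vT] ge[OF that] by (simp add: e_def)
  qed
qed

text \<open>The image of \<open>f\<close> is the copy of \<Gamma> under \<open>e\<close>, in
  vertices and in edges, and \<open>\<phi>\<close> restricted to it inverts
  \<open>e\<close>.\<close>

lemma retraction_idempotent:
  assumes gr: "is_graph R" "is_graph \<Gamma>"
    and hom: "graph_hom \<phi> R \<Gamma>" "graph_hom e \<Gamma> R" and id: "\<And>c. c \<in> verts \<Gamma> \<Longrightarrow> \<phi> (e c) = c"
  defines "f \<equiv> restrict (e \<circ> \<phi>) (verts R)"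
  shows "f \<in> idempotent_endomorphisms R" "image_graph f R \<cong>\<^sub>g \<Gamma>"
proof -
  have phi: "\<phi> x \<in> verts \<Gamma>" if "x \<in> verts R" for x using hom that by (auto simp: graph_hom_def)
  have e: "e c \<in> verts R" if "c \<in> verts \<Gamma>" for c using hom that by (auto simp: graph_hom_def)
  have phiE: "(\<phi> x, \<phi> y) \<in> edges \<Gamma>" if "(x, y) \<in> edges R" for x y
    using hom that by (auto simp: graph_hom_def)
  have eE: "(e c, e d) \<in> edges R" if "(c, d) \<in> edges \<Gamma>" for c d
    using hom that by (auto simp: graph_hom_def)
  have f: "f x = e (\<phi> x)" if "x \<in> verts R" for x
    using that by (simp add: f_def)
  have fE: "(f x, f y) \<in> edges R" if "(x, y) \<in> edges R" for x y
    using that f eE phiE is_graph_edgeD(1,2)[OF gr(1) that] by simp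
  have "compose (verts R) f f = f"
    using phi e id by (auto simp: f_def compose_def fun_eq_iff)
  moreover have "f \<in> verts R \<rightarrow>\<^sub>E verts R"
    using phi e by (auto simp: f_def)
  ultimately show "f \<in> idempotent_endomorphisms R"
    using fE by (auto simp: idempotent_endomorphisms_def endomorphisms_def)
  have V: "f ` verts R = e ` verts \<Gamma>"
  proof
    show "e ` verts \<Gamma> \<subseteq> f ` verts R"
      using e f id by (metis image_eqI image_subsetI)
  qed (use f phi in auto)
  have E: "map_prod f f ` edges R = map_prod e e ` edges \<Gamma>"
  proof
    show "map_prod f f ` edges R \<subseteq> map_prod e e ` edges \<Gamma>"
      using f phiE is_graph_edgeD(1,2)[OF gr(1)] by force
    \<comment> \<open>Since \<open>f\<close> fixes the range of \<open>e\<close>, such an edge is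
      its own image.\<close>
    have "(e c, e d) \<in> map_prod f f ` edges R" if "(c, d) \<in> edges \<Gamma>" for c d
      using that eE e f id is_graph_edgeD(1,2)[OF gr(2) that]
      by (intro image_eqI[of _ _ "(e c, e d)"]) auto
    then show "map_prod e e ` edges \<Gamma> \<subseteq> map_prod f f ` edges R"
      by auto
  qed
  have "bij_betw \<phi> (e ` verts \<Gamma>) (verts \<Gamma>)"
    using id by (intro bij_betw_byWitness[where f' = e]) auto
  moreover have "(e c, e d) \<in> map_prod e e ` edges \<Gamma> \<longleftrightarrow> (c, d) \<in> edges \<Gamma>"
    if "c \<in> verts \<Gamma>" "d \<in> verts \<Gamma>" for c d
  proof
    assume "(e c, e d) \<in> map_prod e e ` edges \<Gamma>"
    then obtain c' d' where "(c', d') \<in> edges \<Gamma>" "e c = e c'" "e d = e d'"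
      by auto
    then show "(c, d) \<in> edges \<Gamma>"
      using id that is_graph_edgeD(1,2)[OF gr(2)] by metis
  qed auto
  ultimately have "graph_iso \<phi> (image_graph f R) \<Gamma>"
    using id by (auto simp: graph_iso_def image_graph_def V E)
  then show "image_graph f R \<cong>\<^sub>g \<Gamma>"
    by (auto simp: isomorphic_def)
qed

section \<open>Counting idempotent endomorphisms\<close>

text \<open>An extensional function is determined by its graph, which numberings of \<open>A\<close>
  and \<open>B\<close> and a pairing function turn into a set of naturals.\<close>

lemma countable_PiE_lepoll:
  assumes "countable A" "countable B"
  shows "(A \<rightarrow>\<^sub>E B) \<lesssim> (UNIV :: nat set set)"
proof -
  define code where "code f = (\<lambda>x. prod_encode (to_nat_on A x, to_nat_on B (f x))) ` A" for f
  have "inj_on code (A \<rightarrow>\<^sub>E B)"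
  proof (rule inj_onI)
    fix f g assume fg: "f \<in> A \<rightarrow>\<^sub>E B" "g \<in> A \<rightarrow>\<^sub>E B" "code f = code g"
    show "f = g"
    proof (rule PiE_ext[OF fg(1,2)])
      fix x assume x: "x \<in> A"
      then have "prod_encode (to_nat_on A x, to_nat_on B (f x)) \<in> code g"
        using fg(3) by (auto simp: code_def)
      then obtain y where y: "y \<in> A" "to_nat_on A x = to_nat_on A y"
          "to_nat_on B (f x) = to_nat_on B (g y)"
        by (auto simp: code_def)
      have "x = y"
        using x y assms by simp
      moreover have "f x \<in> B" "g x \<in> B"
        using fg x by auto
      ultimately show "f x = g x"
        using y(3) assms(2) by simp
    qed
  qed
  then show ?thesis
    by (auto simp: lepoll_def)
qed

lemma continuum_many_idempotents:
  fixes R :: "'a graph" and \<Gamma> :: "'b graph"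
  assumes R: "countable_graph R" "extension_property R"
    and G: "countable_graph \<Gamma>" "algebraically_closed \<Gamma>"
  shows "(UNIV :: nat set set) \<lesssim> {f \<in> idempotent_endomorphisms R. image_graph f R \<cong>\<^sub>g \<Gamma>}"
proof -
  have gr: "is_graph R" "is_graph \<Gamma>" and cnt: "countable (verts \<Gamma>)"
    using assms by (auto simp: countable_graph_def)
  have inf: "infinite (verts \<Gamma>)"
    using algebraically_closed_infinite gr(2) G(2) .
  obtain \<phi> e where hom: "graph_hom \<phi> R (twin_graph \<Gamma>)" "graph_hom e (twin_graph \<Gamma>) R"
    and id: "\<And>c. c \<in> verts (twin_graph \<Gamma>) \<Longrightarrow> \<phi> (e c) = c"
    using retraction_exists[OF R twin_graph_countable[OF G(1)] twin_graph_algebraically_closed[OF G(2)]]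
    by metis
  \<comment> \<open>The set \<open>S\<close> selects the twin marked \<open>True\<close> over
    exactly the vertices whose index lies in \<open>S\<close>. As twin adjacency depends on first
    components only, every selection is a section of \<open>fst \<circ> \<phi>\<close>.\<close>
  define s where "s S c = e (c, to_nat_on (verts \<Gamma>) c \<in> S)" for S c
  define f where "f S = restrict (s S \<circ> (fst \<circ> \<phi>)) (verts R)" for S
  have hom1: "graph_hom (fst \<circ> \<phi>) R \<Gamma>"
    using hom(1) by (fastforce simp: graph_hom_def twin_graph_def)
  have hom2: "graph_hom (s S) \<Gamma> R" for S
    using hom(2) by (fastforce simp: graph_hom_def twin_graph_def s_def)
  have id2: "(fst \<circ> \<phi>) (s S c) = c" if "c \<in> verts \<Gamma>" for S c
    using id that by (simp add: s_def twin_graph_def)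
  have "f S \<in> {f \<in> idempotent_endomorphisms R. image_graph f R \<cong>\<^sub>g \<Gamma>}" for S
    using retraction_idempotent[OF gr hom1 hom2 id2, of S] unfolding f_def by blast
  moreover have "inj f"
  proof (rule injI, rule set_eqI)
    fix S T n assume eq: "f S = f T"
    \<comment> \<open>As \<Gamma> is infinite, every \<open>n\<close> is the index of a vertex.
      Evaluating \<open>f S\<close> at \<open>e (c, True)\<close> reveals which twin of that vertex
      \<open>S\<close> selects.\<close>
    define c where "c = from_nat_into (verts \<Gamma>) n"
    have c: "c \<in> verts \<Gamma>" "to_nat_on (verts \<Gamma>) c = n"
      using inf cnt by (auto simp: c_def from_nat_into infinite_imp_nonempty)
    have tw: "(c, b) \<in> verts (twin_graph \<Gamma>)" for b
      using c by (simp add: twin_graph_def)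
    then have "e (c, True) \<in> verts R"
      using hom(2) by (auto simp: graph_hom_def)
    then have "f X (e (c, True)) = e (c, n \<in> X)" for X
      using id[OF tw] c by (simp add: f_def s_def)
    then have "e (c, n \<in> S) = e (c, n \<in> T)"
      using eq by metis
    then show "n \<in> S \<longleftrightarrow> n \<in> T"
      using id[OF tw] by (metis prod.inject)
  qed
  ultimately show ?thesis
    by (auto simp: lepoll_def)
qed

theorem theorem3p6:
  fixes R :: "'a graph" and \<Gamma> :: "'b graph"
  assumes "countable_universal_graph R"
    and "countable_graph \<Gamma>"
  shows "((\<exists>f\<in>idempotent_endomorphisms R. image_graph f R \<cong>\<^sub>g \<Gamma>) \<longleftrightarrow> algebraically_closed \<Gamma>)
    \<and> (algebraically_closed \<Gamma> \<longrightarrow>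
         {f \<in> idempotent_endomorphisms R. image_graph f R \<cong>\<^sub>g \<Gamma>} \<approx> (UNIV :: nat set set))"
proof -
  let ?I = "{f \<in> idempotent_endomorphisms R. image_graph f R \<cong>\<^sub>g \<Gamma>}"
  have R: "countable_graph R" "extension_property R"
    using assms(1) universal_extension_property[OF assms(1)]
    by (auto simp: countable_universal_graph_def fraisse_limit_def)
  have ac: "algebraically_closed \<Gamma>"
    if "f \<in> idempotent_endomorphisms R" "image_graph f R \<cong>\<^sub>g \<Gamma>" for f
    using extension_property_imp_algebraically_closed[OF R(2)] that
      algebraically_closed_image_graph algebraically_closed_isomorphic by blast
  \<comment> \<open>The upper bound counts all extensional self-maps of a countable set.\<close>
  have "?I \<subseteq> verts R \<rightarrow>\<^sub>E verts R"
    by (auto simp: idempotent_endomorphisms_def endomorphisms_def)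
  then have upper: "?I \<lesssim> (UNIV :: nat set set)"
    using countable_PiE_lepoll[of "verts R" "verts R"] R(1) lepoll_trans[OF subset_imp_lepoll]
    by (simp add: countable_graph_def)
  have card: "?I \<approx> (UNIV :: nat set set)" if "algebraically_closed \<Gamma>"
    using lepoll_antisym[OF upper continuum_many_idempotents[OF R assms(2) that]] .
  \<comment> \<open>Existence in the first claim is read off from the cardinality in the
    second.\<close>
  moreover have "?I \<noteq> {}" if "algebraically_closed \<Gamma>"
    using card[OF that] by (metis UNIV_not_empty eqpoll_empty_iff_empty eqpoll_sym)
  ultimately show ?thesis
    using ac by blast
qed

end
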